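(* The smooth maps $g:\mathbb{R}\to\mathbb{R}$ that are Trivial Minimal Graph Transformations are precisely the maps of one of the forms $g(t)\equiv C$, $g(t)=t+C$, $g(t)=-t+C$, where $C\in\mathbb{R}$ is an arbitrary constant.
   Context: A minimal graph surface is a smooth function $f:\Omega\to\mathbb{R}$ on an open connected set $\Omega\subseteq\mathbb{R}^2$ satisfying the minimal surface equation $(1+f_y^2)f_{xx}-2f_{xy}f_xf_y+(1+f_x^2)f_{yy}=0$ on $\Omega$ (equivalently, its graph is a minimal surface in Euclidean 3-space). A smooth map $g:U\subseteq\mathbb{R}\to\mathbb{R}$ is a minimal graph transformation of the minimal graph surface $f:\Omega\to\mathbb{R}$ if $f(\Omega)\subseteq U$ and $g\circ f:\Omega\to\mathbb{R}$ is again a minimal graph surface. A map $g:\mathbb{R}\to\mathbb{R}$ is a Trivial Minimal Graph Transformation if it is a minimal graph transformation of every minimal graph surface $f:\Omega\to\mathbb{R}$ (for every open connected $\Omega$). *)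

theory Defs
  imports "HOL-Analysis.Analysis"
begin

text \<open>Smoothness is only meaningful here on open sets \<open>S\<close>, since derivatives are taken
  with respect to the full neighbourhood filter. Letting \<open>v\<close> range over all directions,
  \<open>Ck_on k f S\<close> says that \<open>f\<close> is \<open>k\<close> times continuously differentiable on \<open>S\<close>.\<close>

fun Ck_on :: "nat \<Rightarrow> ('a::euclidean_space \<Rightarrow> real) \<Rightarrow> 'a set \<Rightarrow> bool" where
  "Ck_on 0 f S \<longleftrightarrow> continuous_on S f"
| "Ck_on (Suc k) f S \<longleftrightarrow>
     (\<forall>x\<in>S. f differentiable (at x)) \<and>
     (\<forall>v. Ck_on k (\<lambda>x. frechet_derivative f (at x) v) S)"

definition smooth_on :: "('a::euclidean_space \<Rightarrow> real) \<Rightarrow> 'a set \<Rightarrow> bool" where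
  "smooth_on f S \<longleftrightarrow> (\<forall>k. Ck_on k f S)"

definition partial_x :: "(real \<times> real \<Rightarrow> real) \<Rightarrow> real \<times> real \<Rightarrow> real" where
  "partial_x f = (\<lambda>(x, y). deriv (\<lambda>t. f (t, y)) x)"

definition partial_y :: "(real \<times> real \<Rightarrow> real) \<Rightarrow> real \<times> real \<Rightarrow> real" where
  "partial_y f = (\<lambda>(x, y). deriv (\<lambda>t. f (x, t)) y)"

definition minimal_surface_equation :: "(real \<times> real \<Rightarrow> real) \<Rightarrow> real \<times> real \<Rightarrow> bool" where
  "minimal_surface_equation f p \<longleftrightarrow>
     (1 + (partial_y f p)\<^sup>2) * partial_x (partial_x f) p
     - 2 * partial_y (partial_x f) p * partial_x f p * partial_y f p
     + (1 + (partial_x f p)\<^sup>2) * partial_y (partial_y f) p = 0"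

definition minimal_graph_surface :: "(real \<times> real) set \<Rightarrow> (real \<times> real \<Rightarrow> real) \<Rightarrow> bool" where
  "minimal_graph_surface \<Omega> f \<longleftrightarrow>
     open \<Omega> \<and> connected \<Omega> \<and> smooth_on f \<Omega> \<and> (\<forall>p\<in>\<Omega>. minimal_surface_equation f p)"

text \<open>Maps defined on a subset are represented by total functions; all conditions refer only
  to their values on the (open) domain \<open>U\<close> respectively \<open>\<Omega>\<close>.\<close>

definition minimal_graph_transformation ::
  "real set \<Rightarrow> (real \<Rightarrow> real) \<Rightarrow> (real \<times> real) set \<Rightarrow> (real \<times> real \<Rightarrow> real) \<Rightarrow> bool" where
  "minimal_graph_transformation U g \<Omega> f \<longleftrightarrow>
     open U \<and> smooth_on g U \<and> minimal_graph_surface \<Omega> f \<and> f ` \<Omega> \<subseteq> U \<and>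
     minimal_graph_surface \<Omega> (g \<circ> f)"

definition trivial_minimal_graph_transformation :: "(real \<Rightarrow> real) \<Rightarrow> bool" where
  "trivial_minimal_graph_transformation g \<longleftrightarrow>
     (\<forall>\<Omega> f. minimal_graph_surface \<Omega> f \<longrightarrow> minimal_graph_transformation UNIV g \<Omega> f)"

end

theory Submission
  imports Defs "HOL-Computational_Algebra.Polynomial"
begin

text \<open>If \<open>f\<close> satisfies the minimal surface equation, then \<open>g \<circ> f\<close> does so iff
  \<open>g'(1 - g'\<^sup>2) \<Delta>f + g'' |\<nabla>f|\<^sup>2 = 0\<close>. The plane \<open>f(x, y) = x\<close> forces \<open>g'' = 0\<close>, so that
  \<open>g(t) = s t + C\<close>, and Scherk's surface \<open>f(x, y) = ln (cos y) - ln (cos x)\<close>, which is not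
  harmonic, then forces \<open>s\<^sup>3 = s\<close>. Conversely, every \<open>g(t) = s t + C\<close> with \<open>s\<^sup>3 = s\<close>
  preserves the equation.\<close>

section \<open>Smoothness\<close>

lemma frechet_derivative_cong_open:
  assumes "open S" "x \<in> S" "\<And>y. y \<in> S \<Longrightarrow> f y = g y"
  shows "frechet_derivative f (at x) = frechet_derivative g (at x)"
proof -
  have "(f has_derivative D) (at x) \<longleftrightarrow> (g has_derivative D) (at x)" for D
    using assms has_derivative_transform_within_open[of f D x UNIV S g]
      has_derivative_transform_within_open[of g D x UNIV S f] by auto
  then show ?thesis
    by (simp add: frechet_derivative_def)
qed

lemma differentiable_cong_open:
  assumes "open S" "x \<in> S" "\<And>y. y \<in> S \<Longrightarrow> f y = g y" "f differentiable (at x)"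
  shows "g differentiable (at x)"
  using assms has_derivative_transform_within_open[of f _ x UNIV S g]
  unfolding differentiable_def by blast

text \<open>Openness of \<open>S\<close> makes agreement on \<open>S\<close> pass to the derivatives
  at points of \<open>S\<close>, so induction on \<open>k\<close> applies. This allows a derivative
  to be replaced by a formula valid only on \<open>S\<close>.\<close>

lemma Ck_on_cong_open:
  assumes "open S" "\<And>x. x \<in> S \<Longrightarrow> f x = g x" "Ck_on k f S"
  shows "Ck_on k g S"
  using assms(2,3)
proof (induction k arbitrary: f g)
  case 0
  then show ?case
    using continuous_on_cong[of S S f g] by simp
next
  case (Suc k)
  have "g differentiable (at x)" if "x \<in> S" for x
    using differentiable_cong_open[OF assms(1) that, of f g] Suc.prems that by simp
  moreover have "Ck_on k (\<lambda>x. frechet_derivative g (at x) v) S" for v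
  proof (rule Suc.IH)
    show "Ck_on k (\<lambda>x. frechet_derivative f (at x) v) S"
      using Suc.prems(2) by simp
    show "frechet_derivative f (at x) v = frechet_derivative g (at x) v" if "x \<in> S" for x
      using frechet_derivative_cong_open[OF assms(1) that Suc.prems(1)] by simp
  qed
  ultimately show ?case
    by simp
qed

lemma smooth_on_cong_open:
  assumes "open S" "\<And>x. x \<in> S \<Longrightarrow> f x = g x" "smooth_on f S"
  shows "smooth_on g S"
  using assms Ck_on_cong_open[of S f g] unfolding smooth_on_def by blast

text \<open>A proof principle for smoothness: it suffices to find a family of differentiable
  functions that contains \<open>f\<close> and is closed, up to equality on \<open>S\<close>, under
  directional derivatives. Induction on \<open>k\<close> then treats all members at once; for
  \<open>k = 0\<close>, differentiability gives continuity.\<close>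

lemma smooth_on_coinduct:
  assumes "open S" "f \<in> \<F>"
    and step: "\<And>f. f \<in> \<F> \<Longrightarrow> \<exists>D. (\<forall>x\<in>S. (f has_derivative D x) (at x)) \<and>
                                  (\<forall>v. \<exists>h\<in>\<F>. \<forall>x\<in>S. D x v = h x)"
  shows "smooth_on f S"
proof -
  have "Ck_on k f S" if "f \<in> \<F>" for k f
    using that
  proof (induction k arbitrary: f)
    case 0
    then show ?case
      using step[OF 0] has_derivative_continuous
      by (metis Ck_on.simps(1) continuous_at_imp_continuous_on)
  next
    case (Suc k)
    obtain D where D: "\<And>x. x \<in> S \<Longrightarrow> (f has_derivative D x) (at x)"
      and closed: "\<And>v. \<exists>h\<in>\<F>. \<forall>x\<in>S. D x v = h x"
      using step[OF Suc.prems] by blast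
    have "Ck_on k (\<lambda>x. frechet_derivative f (at x) v) S" for v
    proof -
      obtain h where "h \<in> \<F>" and h: "\<And>x. x \<in> S \<Longrightarrow> D x v = h x"
        using closed by blast
      have "h x = frechet_derivative f (at x) v" if "x \<in> S" for x
        by (simp add: h[OF that] flip: frechet_derivative_at[OF D[OF that]])
      then show ?thesis
        by (rule Ck_on_cong_open[OF assms(1) _ Suc.IH[OF \<open>h \<in> \<F>\<close>]])
    qed
    then show ?case
      using D by (auto simp: differentiable_def)
  qed
  then show ?thesis
    using assms(2) by (simp add: smooth_on_def)
qed

lemma smooth_on_has_derivative:
  assumes "smooth_on f S" "x \<in> S"
  shows "(f has_derivative frechet_derivative f (at x)) (at x)"
proof -
  have "Ck_on (Suc 0) f S"
    using assms(1) unfolding smooth_on_def by blast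
  then show ?thesis
    using assms(2) by (simp add: frechet_derivative_works)
qed

lemma smooth_on_frechet_derivative:
  assumes "smooth_on f S"
  shows "smooth_on (\<lambda>x. frechet_derivative f (at x) v) S"
  unfolding smooth_on_def
proof
  fix k
  have "Ck_on (Suc k) f S"
    using assms unfolding smooth_on_def by blast
  then show "Ck_on k (\<lambda>x. frechet_derivative f (at x) v) S"
    by simp
qed

lemma smooth_on_affine:
  assumes "open S" "smooth_on f S"
  shows "smooth_on (\<lambda>x. s * f x + c) S"
proof (rule smooth_on_coinduct[OF assms(1)])
  let ?F = "{\<lambda>x. s * f x + c | f s c. smooth_on f S}"
  show "(\<lambda>x. s * f x + c) \<in> ?F"
    using assms(2) by blast
  fix h assume "h \<in> ?F"
  then obtain f s c where h: "h = (\<lambda>x. s * f x + c)" and f: "smooth_on f S"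
    by blast
  let ?D = "\<lambda>x v. s * frechet_derivative f (at x) v"
  have "(h has_derivative ?D x) (at x)" if "x \<in> S" for x
    unfolding h using smooth_on_has_derivative[OF f that] by (auto intro!: derivative_eq_intros)
  \<comment> \<open>The summand 0 takes the place of the constant \<open>c\<close>, so that the
    directional derivative has the shape required by \<open>?F\<close>.\<close>
  moreover have "(\<lambda>x. ?D x v + 0) \<in> ?F" for v
    using smooth_on_frechet_derivative[OF f]
    by (intro CollectI exI[of _ "\<lambda>x. frechet_derivative f (at x) v"] exI[of _ s] exI[of _ 0]) simp
  ultimately show "\<exists>D. (\<forall>x\<in>S. (h has_derivative D x) (at x)) \<and>
      (\<forall>v. \<exists>h\<in>?F. \<forall>x\<in>S. D x v = h x)"
    by (intro exI[of _ ?D] conjI ballI allI bexI[of _ "\<lambda>x. ?D x _ + 0"]) auto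
qed

text \<open>The derivative of \<open>f\<close> at every point is \<open>f\<close> itself, so each
  directional derivative is constant; \<open>f\<close> together with the constants is a closed
  family.\<close>

lemma smooth_on_bounded_linear:
  assumes "open S" "bounded_linear f"
  shows "smooth_on f S"
proof (rule smooth_on_coinduct[OF assms(1)])
  let ?F = "insert f (range (\<lambda>c _. c))"
  show "f \<in> ?F"
    by simp
  fix h assume "h \<in> ?F"
  then consider "h = f" | c where "h = (\<lambda>_. c)"
    by blast
  then show "\<exists>D. (\<forall>x\<in>S. (h has_derivative D x) (at x)) \<and>
      (\<forall>v. \<exists>h\<in>?F. \<forall>x\<in>S. D x v = h x)"
  proof cases
    case 1
    then show ?thesis
      using bounded_linear_imp_has_derivative[OF assms(2)]
      by (intro exI[of _ "\<lambda>_. f"]) auto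
  next
    case 2
    then show ?thesis
      by (intro exI[of _ "\<lambda>_ _. 0"]) auto
  qed
qed

section \<open>Partial derivatives\<close>

lemma partial_x_eqI:
  assumes "((\<lambda>t. f (t, snd p)) has_real_derivative d) (at (fst p))"
  shows "partial_x f p = d"
  using DERIV_imp_deriv[OF assms] by (simp add: partial_x_def case_prod_beta)

lemma partial_y_eqI:
  assumes "((\<lambda>t. f (fst p, t)) has_real_derivative d) (at (snd p))"
  shows "partial_y f p = d"
  using DERIV_imp_deriv[OF assms] by (simp add: partial_y_def case_prod_beta)

text \<open>The horizontal line through \<open>p\<close> meets \<open>S\<close> in an open set, so
  the two functions agree near \<open>fst p\<close> along it. Second partials need this, since
  formulas for first partials hold only on the domain.\<close>

lemma partial_x_cong_open:
  assumes "open S" "p \<in> S" "\<And>q. q \<in> S \<Longrightarrow> f q = g q"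
  shows "partial_x f p = partial_x g p"
proof -
  have "open ((\<lambda>t. (t, snd p)) -` S)"
    by (intro open_vimage assms(1) continuous_intros)
  then have "\<forall>\<^sub>F t in nhds (fst p). f (t, snd p) = g (t, snd p)"
    using assms by (intro eventually_nhds[THEN iffD2]) (auto intro!: exI[of _ "(\<lambda>t. (t, snd p)) -` S"])
  then show ?thesis
    unfolding partial_x_def case_prod_beta by (rule deriv_cong_ev) simp
qed

lemma partial_y_cong_open:
  assumes "open S" "p \<in> S" "\<And>q. q \<in> S \<Longrightarrow> f q = g q"
  shows "partial_y f p = partial_y g p"
proof -
  have "open (Pair (fst p) -` S)"
    by (intro open_vimage assms(1) continuous_intros)
  then have "\<forall>\<^sub>F t in nhds (snd p). f (fst p, t) = g (fst p, t)"
    using assms by (intro eventually_nhds[THEN iffD2]) (auto intro!: exI[of _ "Pair (fst p) -` S"])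
  then show ?thesis
    unfolding partial_y_def case_prod_beta by (rule deriv_cong_ev) simp
qed

text \<open>The chain rule along the horizontal line through \<open>p\<close> gives the derivative
  \<open>h\<close> \<mapsto> \<open>?D (h, 0)\<close>, which by linearity is multiplication by
  \<open>?D (1, 0)\<close>. This links the coordinate partials to the Frechet derivatives in
  \<open>Ck_on\<close>.\<close>

lemma smooth_on_DERIV_x:
  assumes "smooth_on f S" "p \<in> S"
  shows "((\<lambda>t. f (t, snd p)) has_real_derivative frechet_derivative f (at p) (1, 0)) (at (fst p))"
proof -
  let ?D = "frechet_derivative f (at p)"
  have f: "(f has_derivative ?D) (at (fst p, snd p))"
    using smooth_on_has_derivative[OF assms] by simp
  have "((\<lambda>t. f (t, snd p)) has_derivative (\<lambda>h. ?D (h, 0))) (at (fst p))"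
    by (rule has_derivative_compose[where f = "\<lambda>t. (t, snd p)", OF _ f])
      (intro has_derivative_Pair has_derivative_const has_derivative_ident)
  moreover have "(\<lambda>h. ?D (h, 0)) = (*) (?D (1, 0))"
  proof
    show "?D (h, 0) = ?D (1, 0) * h" for h
      using linear_scale[OF has_derivative_linear[OF f], of h "(1, 0)"] by simp
  qed
  ultimately show ?thesis
    by (simp add: has_field_derivative_def)
qed

lemma smooth_on_DERIV_y:
  assumes "smooth_on f S" "p \<in> S"
  shows "((\<lambda>t. f (fst p, t)) has_real_derivative frechet_derivative f (at p) (0, 1)) (at (snd p))"
proof -
  let ?D = "frechet_derivative f (at p)"
  have f: "(f has_derivative ?D) (at (fst p, snd p))"
    using smooth_on_has_derivative[OF assms] by simp
  have "((\<lambda>t. f (fst p, t)) has_derivative (\<lambda>h. ?D (0, h))) (at (snd p))"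
    by (rule has_derivative_compose[where f = "\<lambda>t. (fst p, t)", OF _ f])
      (intro has_derivative_Pair has_derivative_const has_derivative_ident)
  moreover have "(\<lambda>h. ?D (0, h)) = (*) (?D (0, 1))"
  proof
    show "?D (0, h) = ?D (0, 1) * h" for h
      using linear_scale[OF has_derivative_linear[OF f], of h "(0, 1)"] by simp
  qed
  ultimately show ?thesis
    by (simp add: has_field_derivative_def)
qed

lemma smooth_on_partial_x:
  assumes "open S" "smooth_on f S"
  shows "smooth_on (partial_x f) S"
  using smooth_on_cong_open[OF assms(1) _ smooth_on_frechet_derivative[OF assms(2), of "(1, 0)"]]
    partial_x_eqI[OF smooth_on_DERIV_x[OF assms(2)]] by simp

lemma smooth_on_partial_y:
  assumes "open S" "smooth_on f S"
  shows "smooth_on (partial_y f) S"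
  using smooth_on_cong_open[OF assms(1) _ smooth_on_frechet_derivative[OF assms(2), of "(0, 1)"]]
    partial_y_eqI[OF smooth_on_DERIV_y[OF assms(2)]] by simp

section \<open>Affine changes of the height function\<close>

lemma partial_x_affine:
  assumes "smooth_on f S" "p \<in> S"
  shows "partial_x (\<lambda>q. s * f q + c) p = s * partial_x f p"
  using partial_x_eqI[OF smooth_on_DERIV_x[OF assms]]
  by (auto intro!: partial_x_eqI derivative_eq_intros smooth_on_DERIV_x[OF assms])

lemma partial_y_affine:
  assumes "smooth_on f S" "p \<in> S"
  shows "partial_y (\<lambda>q. s * f q + c) p = s * partial_y f p"
  using partial_y_eqI[OF smooth_on_DERIV_y[OF assms]]
  by (auto intro!: partial_y_eqI derivative_eq_intros smooth_on_DERIV_y[OF assms])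

text \<open>On the open set \<open>S\<close> the first partials of \<open>s * f + c\<close> are
  \<open>s\<close> times those of \<open>f\<close>, and these are smooth again. The first-order
  rules therefore apply a second time, now with constant 0.\<close>

lemma second_partials_affine:
  assumes "open S" "smooth_on f S" "p \<in> S"
  shows "partial_x (partial_x (\<lambda>q. s * f q + c)) p = s * partial_x (partial_x f) p"
    and "partial_y (partial_x (\<lambda>q. s * f q + c)) p = s * partial_y (partial_x f) p"
    and "partial_y (partial_y (\<lambda>q. s * f q + c)) p = s * partial_y (partial_y f) p"
  using partial_x_cong_open[OF assms(1,3) partial_x_affine[OF assms(2)]]
    partial_y_cong_open[OF assms(1,3) partial_x_affine[OF assms(2)]]
    partial_y_cong_open[OF assms(1,3) partial_y_affine[OF assms(2)]]
    partial_x_affine[OF smooth_on_partial_x[OF assms(1,2)] assms(3), of s 0]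
    partial_y_affine[OF smooth_on_partial_x[OF assms(1,2)] assms(3), of s 0]
    partial_y_affine[OF smooth_on_partial_y[OF assms(1,2)] assms(3), of s 0]
  by simp_all

text \<open>The left side of the equation is the Laplacian plus terms of degree three in
  \<open>f\<close>. Under scaling by \<open>s\<close> the former gains a factor \<open>s\<close> and
  the latter \<open>s ^ 3\<close>; subtracting \<open>s ^ 3\<close> times the equation for
  \<open>f\<close> leaves a multiple of the Laplacian.\<close>

lemma minimal_surface_equation_affine:
  assumes "open S" "smooth_on f S" "p \<in> S" and mse: "minimal_surface_equation f p"
  shows "minimal_surface_equation (\<lambda>q. s * f q + c) p \<longleftrightarrow>
    (s - s ^ 3) * (partial_x (partial_x f) p + partial_y (partial_y f) p) = 0"
proof -
  have "(1 + (s * fy)\<^sup>2) * (s * fxx) - 2 * (s * fxy) * (s * fx) * (s * fy)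
      + (1 + (s * fx)\<^sup>2) * (s * fyy)
    = s ^ 3 * ((1 + fy\<^sup>2) * fxx - 2 * fxy * fx * fy + (1 + fx\<^sup>2) * fyy)
      + (s - s ^ 3) * (fxx + fyy)" for fx fy fxx fxy fyy :: real
    by algebra
  then show ?thesis
    using mse
    by (simp add: minimal_surface_equation_def second_partials_affine[OF assms(1-3)]
        partial_x_affine[OF assms(2,3)] partial_y_affine[OF assms(2,3)])
qed

section \<open>Test surfaces\<close>

text \<open>Taking this plane over all of \<open>UNIV\<close> makes its heights exhaust the reals,
  so that it tests \<open>g\<close> at every point.\<close>

lemma minimal_graph_surface_fst: "minimal_graph_surface UNIV fst"
proof -
  have "partial_x fst = (\<lambda>_. 1)" "partial_y fst = (\<lambda>_. 0)"
    by (auto intro!: partial_x_eqI partial_y_eqI derivative_eq_intros)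
  moreover have "partial_x (\<lambda>_. c) p = 0" "partial_y (\<lambda>_. c) p = 0" for c p
    by (auto intro!: partial_x_eqI partial_y_eqI derivative_eq_intros)
  ultimately show ?thesis
    by (simp add: minimal_graph_surface_def minimal_surface_equation_def
        smooth_on_bounded_linear bounded_linear_fst connected_UNIV)
qed

section \<open>Scherk's surface\<close>

definition scherk :: "real \<times> real \<Rightarrow> real" where
  "scherk p = ln (cos (snd p)) - ln (cos (fst p))"

text \<open>A single square on which both cosines are positive: the logarithms have positive
  arguments and the domain is connected.\<close>

definition scherk_domain :: "(real \<times> real) set" where
  "scherk_domain = {- (pi/2) <..< pi/2} \<times> {- (pi/2) <..< pi/2}"

lemma open_scherk_domain: "open scherk_domain"
  by (simp add: scherk_domain_def open_Times)

lemma connected_scherk_domain: "connected scherk_domain"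
  by (simp add: scherk_domain_def connected_Times)

lemma cos_pos_scherk_domain:
  assumes "p \<in> scherk_domain"
  shows "cos (fst p) > 0" "cos (snd p) > 0"
  using assms by (auto simp: scherk_domain_def intro!: cos_gt_zero_pi)

lemma DERIV_ln_cos:
  assumes "cos x > 0"
  shows "((\<lambda>x. ln (cos x)) has_real_derivative - tan x) (at x)"
  using assms by (auto intro!: derivative_eq_intros simp: tan_def field_simps)

text \<open>This form of the derivative is a polynomial in \<open>tan x\<close>, which keeps
  polynomials in the tangent closed under differentiation.\<close>

lemma DERIV_tan_one_plus:
  assumes "cos x \<noteq> (0::real)"
  shows "(tan has_real_derivative 1 + (tan x)\<^sup>2) (at x)"
  using DERIV_tan[OF assms] tan_sec[OF assms] by (simp add: power_inverse)

lemma DERIV_poly_tan: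
  assumes "cos x \<noteq> (0::real)"
  shows "((\<lambda>x. poly p (tan x)) has_real_derivative poly (pderiv p * [:1, 0, 1:]) (tan x)) (at x)"
  by (rule DERIV_cong[OF DERIV_chain2[OF poly_DERIV DERIV_tan_one_plus[OF assms]]])
    (simp add: algebra_simps power2_eq_square)

lemma has_derivative_separated:
  assumes "(u has_real_derivative a) (at (fst z))" "(w has_real_derivative b) (at (snd z))"
  shows "((\<lambda>z. u (fst z) + w (snd z)) has_derivative (\<lambda>v. a * fst v + b * snd v)) (at z)"
proof -
  have "((\<lambda>z. u (fst z)) has_derivative (\<lambda>v. a * fst v)) (at z)"
    using has_derivative_compose[OF has_derivative_fst[OF has_derivative_ident]]
      assms(1) unfolding has_field_derivative_def by blast
  moreover have "((\<lambda>z. w (snd z)) has_derivative (\<lambda>v. b * snd v)) (at z)"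
    using has_derivative_compose[OF has_derivative_snd[OF has_derivative_ident]]
      assms(2) unfolding has_field_derivative_def by blast
  ultimately show ?thesis
    by (rule has_derivative_add)
qed

text \<open>The closed family consists of sums of a function of x and a function of y, each a
  multiple of \<open>ln (cos x)\<close> plus a polynomial in \<open>tan x\<close> in its own
  variable. One differentiation removes the logarithms and leaves polynomials in the
  tangents.\<close>

lemma smooth_on_scherk: "smooth_on scherk scherk_domain"
proof (rule smooth_on_coinduct[OF open_scherk_domain])
  define \<phi> :: "real \<Rightarrow> real poly \<Rightarrow> real \<Rightarrow> real"
    where "\<phi> a p x = a * ln (cos x) + poly p (tan x)" for a p x
  \<comment> \<open>The polynomial whose value at \<open>tan x\<close> is the derivative of
    \<open>\<phi> a p\<close>: the logarithm contributes \<open>- a * tan x\<close>, and the chain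
    rule multiplies \<open>pderiv p\<close> by 1 + X^2.\<close>
  define \<phi>' where "\<phi>' a p = pderiv p * [:1, 0, 1:] + [:0, - a:]" for a and p :: "real poly"
  let ?F = "{\<lambda>z. \<phi> a p (fst z) + \<phi> b q (snd z) | a p b q. True}"
  have "scherk = (\<lambda>z. \<phi> (-1) 0 (fst z) + \<phi> 1 0 (snd z))"
    by (auto simp: scherk_def \<phi>_def)
  then show "scherk \<in> ?F"
    by blast
  fix h assume "h \<in> ?F"
  then obtain a p b q where h: "h = (\<lambda>z. \<phi> a p (fst z) + \<phi> b q (snd z))"
    by blast
  have \<phi>: "(\<phi> a p has_real_derivative poly (\<phi>' a p) (tan x)) (at x)" if "cos x > 0" for a p x
    unfolding \<phi>_def [abs_def] \<phi>'_def
    by (rule DERIV_cong[OF DERIV_add[OF DERIV_cmult[OF DERIV_ln_cos[OF that]] DERIV_poly_tan]])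
      (use that in \<open>auto simp: algebra_simps\<close>)
  let ?D = "\<lambda>z v. poly (\<phi>' a p) (tan (fst z)) * fst v + poly (\<phi>' b q) (tan (snd z)) * snd v"
  have "(h has_derivative ?D z) (at z)" if "z \<in> scherk_domain" for z
    unfolding h using that by (intro has_derivative_separated \<phi> cos_pos_scherk_domain)
  moreover have "\<exists>h\<in>?F. \<forall>z\<in>scherk_domain. ?D z v = h z" for v
  proof -
    \<comment> \<open>For a fixed direction \<open>v\<close> its coordinates are constants and can
      be absorbed into the polynomials; the logarithms get coefficient 0.\<close>
    let ?h = "\<lambda>z. \<phi> 0 (smult (fst v) (\<phi>' a p)) (fst z) + \<phi> 0 (smult (snd v) (\<phi>' b q)) (snd z)"
    show ?thesis
    proof (rule bexI[of _ ?h], rule ballI)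
      show "?D z v = ?h z" for z
        by (simp add: \<phi>_def)
      show "?h \<in> ?F"
        by blast
    qed
  qed
  ultimately show "\<exists>D. (\<forall>z\<in>scherk_domain. (h has_derivative D z) (at z)) \<and>
      (\<forall>v. \<exists>h\<in>?F. \<forall>z\<in>scherk_domain. D z v = h z)"
    by (intro exI[of _ ?D]) blast
qed

lemma partials_scherk:
  assumes "p \<in> scherk_domain"
  shows "partial_x scherk p = tan (fst p)" "partial_y scherk p = - tan (snd p)"
proof -
  note cos = cos_pos_scherk_domain[OF assms]
  show "partial_x scherk p = tan (fst p)"
    using DERIV_diff[OF DERIV_const DERIV_ln_cos[OF cos(1)]]
    by (intro partial_x_eqI) (simp add: scherk_def)
  show "partial_y scherk p = - tan (snd p)"
    using DERIV_diff[OF DERIV_ln_cos[OF cos(2)] DERIV_const]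
    by (intro partial_y_eqI) (simp add: scherk_def)
qed

lemma second_partials_scherk:
  assumes "p \<in> scherk_domain"
  shows "partial_x (partial_x scherk) p = 1 + (tan (fst p))\<^sup>2"
    and "partial_y (partial_x scherk) p = 0"
    and "partial_y (partial_y scherk) p = - (1 + (tan (snd p))\<^sup>2)"
proof -
  note cos = cos_pos_scherk_domain[OF assms]
  have "partial_x (\<lambda>p. tan (fst p)) p = 1 + (tan (fst p))\<^sup>2"
    using DERIV_tan_one_plus[of "fst p"] cos by (auto intro!: partial_x_eqI)
  then show "partial_x (partial_x scherk) p = 1 + (tan (fst p))\<^sup>2"
    using partial_x_cong_open[OF open_scherk_domain assms partials_scherk(1)] by simp
  have "partial_y (\<lambda>p. tan (fst p)) p = 0"
    by (simp add: partial_y_def case_prod_beta)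
  then show "partial_y (partial_x scherk) p = 0"
    using partial_y_cong_open[OF open_scherk_domain assms partials_scherk(1)] by simp
  have "partial_y (\<lambda>p. - tan (snd p)) p = - (1 + (tan (snd p))\<^sup>2)"
    using DERIV_minus[OF DERIV_tan_one_plus[of "snd p"]] cos by (auto intro!: partial_y_eqI)
  then show "partial_y (partial_y scherk) p = - (1 + (tan (snd p))\<^sup>2)"
    using partial_y_cong_open[OF open_scherk_domain assms partials_scherk(2)] by simp
qed

text \<open>The mixed partial vanishes, and the two remaining terms are the product of 1 + tan^2 x
  and 1 + tan^2 y with opposite signs.\<close>

lemma minimal_surface_equation_scherk:
  assumes "p \<in> scherk_domain"
  shows "minimal_surface_equation scherk p"
  by (simp add: minimal_surface_equation_def partials_scherk[OF assms]
      second_partials_scherk[OF assms] algebra_simps)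

lemma minimal_graph_surface_scherk: "minimal_graph_surface scherk_domain scherk"
  by (simp add: minimal_graph_surface_def open_scherk_domain connected_scherk_domain
      smooth_on_scherk minimal_surface_equation_scherk)

section \<open>Trivial minimal graph transformations\<close>

lemma minimal_graph_surface_affine:
  assumes "minimal_graph_surface \<Omega> f" "s ^ 3 = s"
  shows "minimal_graph_surface \<Omega> (\<lambda>p. s * f p + c)"
  using assms by (simp add: minimal_graph_surface_def smooth_on_affine
      minimal_surface_equation_affine[of \<Omega>])

lemma trivial_minimal_graph_transformation_affine:
  assumes "s ^ 3 = s"
  shows "trivial_minimal_graph_transformation (\<lambda>t. s * t + c)"
  using minimal_graph_surface_affine[OF _ assms]
    smooth_on_affine[OF open_UNIV smooth_on_bounded_linear[OF open_UNIV bounded_linear_ident]]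
  by (simp add: trivial_minimal_graph_transformation_def minimal_graph_transformation_def o_def)

section \<open>Conditions on g forced by the test surfaces\<close>

lemma minimal_graph_surface_comp_fst:
  assumes "minimal_graph_surface UNIV (g \<circ> fst)"
  shows "deriv (deriv g) x = 0"
proof -
  \<comment> \<open>Both rules are stated for every function so that they apply again to
    \<open>deriv g\<close>. With all y-partials zero, only the second x-derivative of
    \<open>g\<close> survives in the equation.\<close>
  have x: "partial_x (\<lambda>p. g (fst p)) = (\<lambda>p. deriv g (fst p))" for g
    by (auto simp: partial_x_def)
  have y: "partial_y (\<lambda>p. g (fst p)) = (\<lambda>_. 0)" for g
    by (auto simp: partial_y_def)
  have "partial_y (\<lambda>_. 0) = (\<lambda>_. 0)"
    by (auto simp: partial_y_def)
  then show ?thesis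
    using assms by (simp add: minimal_graph_surface_def minimal_surface_equation_def o_def x y)
qed

lemma smooth_on_real_DERIV:
  fixes g :: "real \<Rightarrow> real"
  assumes "smooth_on g S" "x \<in> S"
  shows "(g has_real_derivative deriv g x) (at x)"
  using smooth_on_has_derivative[OF assms]
  by (metis DERIV_imp_deriv differentiable_def real_differentiable_def)

lemma smooth_on_deriv:
  fixes g :: "real \<Rightarrow> real"
  assumes "open S" "smooth_on g S"
  shows "smooth_on (deriv g) S"
proof (rule smooth_on_cong_open[OF assms(1) _ smooth_on_frechet_derivative[OF assms(2), of 1]])
  fix x assume "x \<in> S"
  from smooth_on_real_DERIV[OF assms(2) this]
  have "(g has_derivative (*) (deriv g x)) (at x)"
    by (simp add: has_field_derivative_def)
  then show "frechet_derivative g (at x) 1 = deriv g x"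
    by (simp flip: frechet_derivative_at)
qed

text \<open>A function with zero derivative on the whole line is constant. This is used first for
  \<open>deriv g\<close>, then for \<open>g\<close> minus the linear function of slope
  \<open>deriv g 0\<close>.\<close>

lemma deriv_deriv_eq_0_imp_affine:
  fixes g :: "real \<Rightarrow> real"
  assumes "smooth_on g UNIV" "\<And>x. deriv (deriv g) x = 0"
  obtains s c where "g = (\<lambda>t. s * t + c)"
proof -
  have *: "deriv g x = deriv g 0" for x
    using DERIV_isconst_all[of "deriv g"] assms(2)
      smooth_on_real_DERIV[OF smooth_on_deriv[OF open_UNIV assms(1)]] by fastforce
  then have "(g has_real_derivative deriv g 0) (at x)" for x
    using smooth_on_real_DERIV[OF assms(1), of x] by (simp only: *[of x] UNIV_I)
  then have "((\<lambda>t. g t - deriv g 0 * t) has_real_derivative 0) (at x)" for x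
    by (auto intro!: derivative_eq_intros)
  then have const: "g t - deriv g 0 * t = g 0 - deriv g 0 * 0" for t
    by (intro DERIV_isconst_all[of "\<lambda>t. g t - deriv g 0 * t"] allI)
  have "g = (\<lambda>t. deriv g 0 * t + g 0)"
  proof
    show "g t = deriv g 0 * t + g 0" for t
      using const[of t] by simp
  qed
  then show ?thesis
    by (rule that)
qed

lemma minimal_graph_surface_affine_scherk:
  assumes "minimal_graph_surface scherk_domain (\<lambda>p. s * scherk p + c)"
  shows "s ^ 3 = s"
proof -
  \<comment> \<open>Here the tangents are 1 and 0, so the Laplacian of \<open>scherk\<close> is 2 -
    1 = 1 and the condition becomes \<open>s - s ^ 3 = 0\<close>. At the origin the Laplacian would
    vanish and give no information.\<close>
  let ?p = "(pi/4, 0) :: real \<times> real"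
  have p: "?p \<in> scherk_domain"
    by (simp add: scherk_domain_def)
  then have "minimal_surface_equation (\<lambda>p. s * scherk p + c) ?p"
    using assms by (simp add: minimal_graph_surface_def)
  then show ?thesis
    by (simp add: minimal_surface_equation_affine[OF open_scherk_domain smooth_on_scherk p
          minimal_surface_equation_scherk[OF p]] second_partials_scherk[OF p] tan_45)
qed

lemma trivial_minimal_graph_transformation_iff:
  assumes "smooth_on g UNIV"
  shows "trivial_minimal_graph_transformation g \<longleftrightarrow> (\<exists>s c. s ^ 3 = s \<and> g = (\<lambda>t. s * t + c))"
proof
  assume "trivial_minimal_graph_transformation g"
  then have comp: "minimal_graph_surface \<Omega> (g \<circ> f)" if "minimal_graph_surface \<Omega> f" for \<Omega> f
    using that
    by (simp add: trivial_minimal_graph_transformation_def minimal_graph_transformation_def)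
  obtain s c where g: "g = (\<lambda>t. s * t + c)"
    using deriv_deriv_eq_0_imp_affine[OF assms]
      minimal_graph_surface_comp_fst[OF comp[OF minimal_graph_surface_fst]] by blast
  have "s ^ 3 = s"
    using comp[OF minimal_graph_surface_scherk] minimal_graph_surface_affine_scherk
    by (simp add: g o_def)
  then show "\<exists>s c. s ^ 3 = s \<and> g = (\<lambda>t. s * t + c)"
    using g by blast
qed (auto intro: trivial_minimal_graph_transformation_affine)

theorem theorem2p2:
  "{g :: real \<Rightarrow> real. smooth_on g UNIV \<and> trivial_minimal_graph_transformation g}
   = {g. \<exists>C::real. g = (\<lambda>t. C) \<or> g = (\<lambda>t. t + C) \<or> g = (\<lambda>t. - t + C)}"
proof -
  have cube: "s ^ 3 = s \<longleftrightarrow> s = 0 \<or> s = 1 \<or> s = - 1" for s :: real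
  proof -
    have "s ^ 3 - s = s * ((s - 1) * (s + 1))"
      by algebra
    then show ?thesis
      by (metis add_eq_0_iff diff_eq_diff_eq eq_iff_diff_eq_0 mult_eq_0_iff minus_minus)
  qed
  have smooth: "smooth_on (\<lambda>t. s * t + c) UNIV" for s c :: real
    by (intro smooth_on_affine smooth_on_bounded_linear open_UNIV bounded_linear_ident)
  have "smooth_on g UNIV \<and> trivial_minimal_graph_transformation g
      \<longleftrightarrow> (\<exists>s c. s ^ 3 = s \<and> g = (\<lambda>t. s * t + c))" for g
    using trivial_minimal_graph_transformation_iff smooth by blast
  also have "(\<exists>s c. s ^ 3 = s \<and> g = (\<lambda>t. s * t + c)) \<longleftrightarrow> 
      (\<exists>C. g = (\<lambda>t. C) \<or> g = (\<lambda>t. t + C) \<or> g = (\<lambda>t. - t + C))" for g :: "real \<Rightarrow> real"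
  proof -
    \<comment> \<open>The three roots of \<open>s ^ 3 = s\<close> give the three families; the slope
      0 yields the constant maps.\<close>
    have "(\<exists>s c. s ^ 3 = s \<and> g = (\<lambda>t. s * t + c)) \<longleftrightarrow>
        (\<exists>c. g = (\<lambda>t. 0 * t + c) \<or> g = (\<lambda>t. 1 * t + c) \<or> g = (\<lambda>t. (- 1) * t + c))"
      unfolding cube by blast
    then show ?thesis
      by simp
  qed
  finally show ?thesis
    by blast
qed

end
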